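(* Let $Q\in\mathbb{R}^{n\times n}$ be symmetric with $\lambda_Q<0$, let $g\in\mathbb{R}^n$, $A\in\mathbb{R}^{m\times n}$, $b\in\mathbb{R}^m$, and let $\mathcal{K}\subseteq\mathbb{R}^m$ be a closed convex cone such that $\{y\in\mathbb{R}^n:\|y\|\le 1,\ Ay-b\in\mathcal{K}\}$ is nonempty. Suppose that there exists a vector $d\in\mathbb{R}^n$, $d\neq 0$, such that $Qd=\lambda_Q d$, $Ad\in\mathcal{K}$ and $g^\top d\le 0$. Then the convex relaxation $$\mathrm{Opt}_f=\min_y\{f(y):\ \|y\|\le 1,\ Ay-b\in\mathcal{K}\}$$ of the problem $$\mathrm{Opt}_h=\min_y\{h(y):\ \|y\|\le 1,\ Ay-b\in\mathcal{K}\}$$ is tight, i.e. $\mathrm{Opt}_f=\mathrm{Opt}_h$.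
   Context: $\|\cdot\|$ is the Euclidean norm and $\lambda_Q:=\lambda_{\min}(Q)$ is the minimum eigenvalue of $Q$. The objective functions are $$h(y):=y^\top Qy+2g^\top y,\qquad f(y):=h(y)+\lambda_Q(1-\|y\|^2)=y^\top(Q-\lambda_Q I_n)y+2g^\top y+\lambda_Q.$$ *)

theory Defs
  imports "HOL-Analysis.Analysis"
begin

definition eigenvalues :: "real ^ 'n ^ 'n \<Rightarrow> real set" where
  "eigenvalues Q = {l. \<exists>v. v \<noteq> 0 \<and> Q *v v = l *\<^sub>R v}"

(* Meaningful when the set of real eigenvalues is finite and nonempty,
   in particular for every symmetric Q. *)
definition lambda_min :: "real ^ 'n ^ 'n \<Rightarrow> real" where
  "lambda_min Q = Min (eigenvalues Q)"

definition obj_h :: "real ^ 'n ^ 'n \<Rightarrow> real ^ 'n \<Rightarrow> real ^ 'n \<Rightarrow> real" where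
  "obj_h Q g y = y \<bullet> (Q *v y) + 2 * (g \<bullet> y)"

definition obj_f :: "real ^ 'n ^ 'n \<Rightarrow> real ^ 'n \<Rightarrow> real ^ 'n \<Rightarrow> real" where
  "obj_f Q g y = obj_h Q g y + lambda_min Q * (1 - (norm y)\<^sup>2)"

definition feasible :: "real ^ 'n ^ 'm \<Rightarrow> real ^ 'm \<Rightarrow> (real ^ 'm) set \<Rightarrow> (real ^ 'n) set" where
  "feasible A b K = {y. norm y \<le> 1 \<and> A *v y - b \<in> K}"

(* The optimal value of a minimisation problem. It is a minimum precisely when some
   point of S satisfies is_arg_min; if the objective is unbounded below on S, or S is empty,
   the real-valued infimum is unspecified. *)
definition opt_val :: "('a \<Rightarrow> real) \<Rightarrow> 'a set \<Rightarrow> real" where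
  "opt_val \<phi> S = (INF y\<in>S. \<phi> y)"

(* Minimising \<phi> over S is a convex problem that underestimates minimising \<psi> over S;
   the feasible set itself is not enlarged. *)
definition convex_relaxation ::
  "('a::real_vector \<Rightarrow> real) \<Rightarrow> ('a \<Rightarrow> real) \<Rightarrow> 'a set \<Rightarrow> bool" where
  "convex_relaxation \<phi> \<psi> S \<longleftrightarrow> convex S \<and> convex_on S \<phi> \<and> (\<forall>y\<in>S. \<phi> y \<le> \<psi> y)"

end

theory Submission
  imports Defs
begin

text \<open>
  Since \<open>Q - \<lambda>\<^sub>Q I\<close> is positive semidefinite with kernel vector \<open>d\<close>, the function \<open>f\<close> is convex and,
  along \<open>d\<close>, affine with slope \<open>2 g\<^sup>T d \<le> 0\<close>. A minimiser of \<open>f\<close> can therefore be moved in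
  direction \<open>d\<close>, which preserves the conic constraint, until it reaches the unit sphere; there
  \<open>f = h\<close>, and \<open>f \<le> h\<close> on the whole unit ball.
\<close>

lemma symmetric_matrix_inner:
  fixes M :: "real ^ 'n ^ 'n"
  assumes "transpose M = M"
  shows "x \<bullet> (M *v y) = y \<bullet> (M *v x)"
  using assms dot_lmul_matrix[of x M y] by (simp add: inner_commute flip: transpose_matrix_vector)

lemma quadratic_form_add:
  fixes M :: "real ^ 'n ^ 'n"
  assumes "transpose M = M"
  shows "(x + t *\<^sub>R y) \<bullet> (M *v (x + t *\<^sub>R y)) =
    x \<bullet> (M *v x) + 2 * t * (y \<bullet> (M *v x)) + t\<^sup>2 * (y \<bullet> (M *v y))"
  using symmetric_matrix_inner[OF assms, of x y]
  by (simp add: matrix_vector_right_distrib matrix_vector_mult_scaleR inner_add power2_eq_square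
      algebra_simps)

text \<open>If \<open>w = M *v v\<close> were nonzero, moving from \<open>v\<close> along
  \<open>w\<close> would change the form by \<open>2 * t * (w \<bullet> w) + t\<^sup>2 * a\<close>.
  Its linear term dominates for small negative \<open>t\<close>, which contradicts
  semidefiniteness.\<close>

lemma psd_null_vector:
  fixes M :: "real ^ 'n ^ 'n"
  assumes sym: "transpose M = M" and psd: "\<And>x. 0 \<le> x \<bullet> (M *v x)" and v: "v \<bullet> (M *v v) = 0"
  shows "M *v v = 0"
proof (rule ccontr)
  assume "M *v v \<noteq> 0"
  define w where "w = M *v v"
  define a where "a = w \<bullet> (M *v w)"
  have pos: "0 < w \<bullet> w" using \<open>M *v v \<noteq> 0\<close> by (simp add: w_def)
  have a0: "0 \<le> a" using psd by (simp add: a_def)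
  have quad: "0 \<le> 2 * t * (w \<bullet> w) + t\<^sup>2 * a" for t
    using psd[of "v + t *\<^sub>R w"] by (simp add: quadratic_form_add[OF sym] v a_def w_def)
  \<comment> \<open>For \<open>a > 0\<close> the quadratic in \<open>t\<close> is minimal at
    \<open>- (w \<bullet> w) / a\<close>. The denominator \<open>a + 1\<close> also covers
    \<open>a = 0\<close> and still gives a negative value.\<close>
  define t where "t = - ((w \<bullet> w) / (a + 1))"
  have "t * (a + 1) = - (w \<bullet> w)" using a0 by (simp add: t_def)
  then have ta: "t * a = - (w \<bullet> w) - t" by (simp add: algebra_simps)
  have "t < 0" using pos a0 by (simp add: t_def)
  have "2 * t * (w \<bullet> w) + t\<^sup>2 * a = t * (w \<bullet> w - t)"
    unfolding power2_eq_square mult.assoc ta by (simp add: algebra_simps)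
  also have "\<dots> < 0" using \<open>t < 0\<close> pos by (intro mult_neg_pos) linarith+
  finally show False using quad[of t] by simp
qed

text \<open>Evaluating \<open>v \<bullet> (Q *v w)\<close> from either side gives
  \<open>l * (v \<bullet> w) = k * (v \<bullet> w)\<close>.\<close>

lemma eigenvectors_orthogonal:
  fixes Q :: "real ^ 'n ^ 'n"
  assumes "transpose Q = Q" "Q *v v = l *\<^sub>R v" "Q *v w = k *\<^sub>R w" "l \<noteq> k"
  shows "orthogonal v w"
  using symmetric_matrix_inner[OF assms(1), of v w] assms(2-4)
  by (simp add: orthogonal_def inner_commute)

text \<open>One eigenvector chosen per eigenvalue gives a pairwise orthogonal family without 0,
  which is independent and hence finite. Finiteness is what gives \<open>Min\<close> in
  \<open>lambda_min\<close> its meaning.\<close>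

lemma finite_eigenvalues_symmetric:
  fixes Q :: "real ^ 'n ^ 'n"
  assumes sym: "transpose Q = Q"
  shows "finite (eigenvalues Q)"
proof -
  obtain v where v: "\<And>l. l \<in> eigenvalues Q \<Longrightarrow> v l \<noteq> 0 \<and> Q *v v l = l *\<^sub>R v l"
  proof -
    have "\<forall>l\<in>eigenvalues Q. \<exists>v. v \<noteq> 0 \<and> Q *v v = l *\<^sub>R v"
      by (simp add: eigenvalues_def)
    from bchoice[OF this] show thesis using that by blast
  qed
  have orth: "orthogonal (v l) (v k)" if "l \<in> eigenvalues Q" "k \<in> eigenvalues Q" "l \<noteq> k" for l k
    using eigenvectors_orthogonal[OF sym] v that by blast
  have inj: "inj_on v (eigenvalues Q)"
    using orth v by (intro inj_onI) (metis orthogonal_self)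
  have "pairwise orthogonal (v ` eigenvalues Q)"
    using orth by (auto simp: pairwise_def)
  moreover have "0 \<notin> v ` eigenvalues Q" using v by force
  ultimately have "finite (v ` eigenvalues Q)"
    using pairwise_orthogonal_independent finiteI_independent by blast
  then show ?thesis using inj finite_imageD by blast
qed

lemma transpose_shift:
  fixes Q :: "real ^ 'n ^ 'n"
  assumes "transpose Q = Q"
  shows "transpose (Q - c *\<^sub>R mat 1) = Q - c *\<^sub>R mat 1"
  using assms by (auto simp: transpose_def vec_eq_iff mat_def)

lemma shift_mult_vector:
  fixes Q :: "real ^ 'n ^ 'n"
  shows "(Q - c *\<^sub>R mat 1) *v x = Q *v x - c *\<^sub>R x"
  by (simp add: matrix_vector_mult_diff_rdistrib scaleR_matrix_vector_assoc[symmetric])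

text \<open>Take \<mu> as the minimum of the quadratic form of \<open>Q\<close> on the compact unit
  sphere. By homogeneity the form shifted by \<mu> is semidefinite, and it vanishes at the
  minimiser, which is therefore an eigenvector for \<mu>.\<close>

lemma rayleigh_minimum:
  fixes Q :: "real ^ 'n ^ 'n"
  assumes sym: "transpose Q = Q"
  obtains \<mu> where "\<mu> \<in> eigenvalues Q" "\<And>x. 0 \<le> x \<bullet> ((Q - \<mu> *\<^sub>R mat 1) *v x)"
proof -
  have "sphere (0 :: real ^ 'n) 1 \<noteq> {}" by simp
  moreover have "continuous_on (sphere 0 1) (\<lambda>x. x \<bullet> (Q *v x))"
    by (intro continuous_intros)
  ultimately obtain v where v: "norm v = 1"
    and min: "\<And>x. norm x = 1 \<Longrightarrow> v \<bullet> (Q *v v) \<le> x \<bullet> (Q *v x)"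
    using continuous_attains_inf[OF compact_sphere, of "0 :: real ^ 'n" 1 "\<lambda>x. x \<bullet> (Q *v x)"] by auto
  define \<mu> where "\<mu> = v \<bullet> (Q *v v)"
  have psd: "0 \<le> x \<bullet> ((Q - \<mu> *\<^sub>R mat 1) *v x)" for x
  proof (cases "x = 0")
    case False
    have "\<mu> \<le> (x /\<^sub>R norm x) \<bullet> (Q *v (x /\<^sub>R norm x))"
      unfolding \<mu>_def using False by (intro min) simp
    then have "\<mu> * (norm x)\<^sup>2 \<le> x \<bullet> (Q *v x)"
      using False by (simp add: matrix_vector_mult_scaleR power2_eq_square field_simps)
    then show ?thesis
      by (simp add: shift_mult_vector inner_diff_right power2_norm_eq_inner)
  qed simp
  have "(Q - \<mu> *\<^sub>R mat 1) *v v = 0"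
    using v by (intro psd_null_vector transpose_shift sym psd)
      (simp add: shift_mult_vector inner_diff_right \<mu>_def norm_eq_1)
  then have "\<mu> \<in> eigenvalues Q"
    using v by (auto simp: eigenvalues_def shift_mult_vector intro!: exI[of _ v])
  with psd show thesis by (rule that[rotated])
qed

text \<open>The shift by the Rayleigh minimum \<mu> is semidefinite. Since \<mu> is an eigenvalue,
  \<open>lambda_min Q\<close> is at most \<mu>, and a smaller shift only increases the form.\<close>

lemma psd_shift_lambda_min:
  fixes Q :: "real ^ 'n ^ 'n"
  assumes sym: "transpose Q = Q"
  shows "0 \<le> x \<bullet> ((Q - lambda_min Q *\<^sub>R mat 1) *v x)"
proof -
  obtain \<mu> where \<mu>: "\<mu> \<in> eigenvalues Q" and psd: "\<And>x. 0 \<le> x \<bullet> ((Q - \<mu> *\<^sub>R mat 1) *v x)"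
    using rayleigh_minimum[OF sym] by blast
  have "lambda_min Q \<le> \<mu>"
    unfolding lambda_min_def using \<mu> finite_eigenvalues_symmetric[OF sym] by simp
  then have "lambda_min Q * (x \<bullet> x) \<le> \<mu> * (x \<bullet> x)"
    by (simp add: mult_right_mono)
  with psd[of x] show ?thesis
    by (simp add: shift_mult_vector inner_diff_right)
qed

text \<open>On the segment from \<open>x\<close> to \<open>y\<close> the function is quadratic in
  \<open>t\<close> with leading coefficient \<open>q\<close>, the form at \<open>y - x\<close>. The
  convexity gap is \<open>(t - t\<^sup>2) * q\<close>, which is nonnegative.\<close>

lemma convex_on_quadratic:
  fixes M :: "real ^ 'n ^ 'n"
  assumes sym: "transpose M = M" and psd: "\<And>x. 0 \<le> x \<bullet> (M *v x)" and "convex S"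
  shows "convex_on S (\<lambda>x. x \<bullet> (M *v x) + 2 * (g \<bullet> x) + c)"
proof (intro convex_onI \<open>convex S\<close>)
  fix t :: real and x y :: "real ^ 'n" assume t: "0 < t" "t < 1"
  have eq: "(1 - t) *\<^sub>R x + t *\<^sub>R y = x + t *\<^sub>R (y - x)"
    by (simp add: algebra_simps)
  define q where "q = (y - x) \<bullet> (M *v (y - x))"
  define p where "p = (y - x) \<bullet> (M *v x)"
  have "y \<bullet> (M *v y) = x \<bullet> (M *v x) + 2 * p + q"
    using quadratic_form_add[OF sym, of x 1 "y - x"] by (simp add: p_def q_def)
  moreover have "(x + t *\<^sub>R (y - x)) \<bullet> (M *v (x + t *\<^sub>R (y - x)))
      = x \<bullet> (M *v x) + 2 * t * p + t\<^sup>2 * q"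
    by (simp add: quadratic_form_add[OF sym] p_def q_def)
  moreover have "t\<^sup>2 * q \<le> t * q"
    using t psd[of "y - x"] by (intro mult_right_mono) (auto simp: q_def power2_eq_square)
  ultimately show "((1 - t) *\<^sub>R x + t *\<^sub>R y) \<bullet> (M *v ((1 - t) *\<^sub>R x + t *\<^sub>R y))
      + 2 * (g \<bullet> ((1 - t) *\<^sub>R x + t *\<^sub>R y)) + c
    \<le> (1 - t) * (x \<bullet> (M *v x) + 2 * (g \<bullet> x) + c) + t * (y \<bullet> (M *v y) + 2 * (g \<bullet> y) + c)"
    unfolding eq by (simp add: inner_add inner_diff_right algebra_simps)
qed

lemma obj_f_quadratic:
  "obj_f Q g = (\<lambda>x. x \<bullet> ((Q - lambda_min Q *\<^sub>R mat 1) *v x) + 2 * (g \<bullet> x) + lambda_min Q)"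
  by (simp add: obj_f_def obj_h_def shift_mult_vector power2_norm_eq_inner inner_diff_right
      right_diff_distrib fun_eq_iff)

text \<open>The shifted matrix annihilates \<open>d\<close>, so both the cross term and the square
  term vanish and only the linear part of \<open>f\<close> changes.\<close>

lemma obj_f_add_eigenvector:
  assumes "transpose Q = Q" "Q *v d = lambda_min Q *\<^sub>R d"
  shows "obj_f Q g (y + t *\<^sub>R d) = obj_f Q g y + 2 * t * (g \<bullet> d)"
proof -
  have "(Q - lambda_min Q *\<^sub>R mat 1) *v d = 0"
    using assms(2) by (simp add: shift_mult_vector)
  moreover from this have "d \<bullet> ((Q - lambda_min Q *\<^sub>R mat 1) *v y) = 0"
    using symmetric_matrix_inner[OF transpose_shift[OF assms(1)], of d _ y] by simp
  ultimately show ?thesis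
    by (simp add: obj_f_quadratic quadratic_form_add[OF transpose_shift[OF assms(1)]]
        inner_add_right)
qed

lemma feasible_eq: "feasible A b K = cball 0 1 \<inter> (\<lambda>y. A *v y - b) -` K"
  by (auto simp: feasible_def)

lemma compact_feasible:
  assumes "closed K"
  shows "compact (feasible A b K)"
  unfolding feasible_eq
  by (intro compact_Int_closed compact_cball closed_vimage assms continuous_intros)

lemma convex_feasible:
  assumes "convex K"
  shows "convex (feasible A b K)"
proof -
  \<comment> \<open>Moving the offset \<open>b\<close> onto the cone turns an affine preimage into a
    linear preimage of a translate.\<close>
  have "(\<lambda>y. A *v y - b) -` K = (*v) A -` ((+) b ` K)"
    by (force simp: image_iff algebra_simps)
  then show ?thesis
    unfolding feasible_eq
    by (metis convex_Int convex_cball convex_linear_vimage convex_translation assms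
        matrix_vector_mul_linear)
qed

lemma is_arg_min_on_compact:
  fixes \<phi> :: "'a :: topological_space \<Rightarrow> real"
  assumes "compact S" "S \<noteq> {}" "continuous_on S \<phi>"
  obtains y where "is_arg_min \<phi> (\<lambda>y. y \<in> S) y"
  using continuous_attains_inf[OF assms] by (auto simp: is_arg_min_linorder)

lemma opt_val_eq:
  assumes "is_arg_min \<phi> (\<lambda>y. y \<in> S) y"
  shows "opt_val \<phi> S = \<phi> y"
  unfolding opt_val_def using assms
  by (intro cInf_eq_minimum) (auto simp: is_arg_min_linorder)

lemma ray_meets_unit_sphere:
  fixes y d :: "'a :: real_normed_vector"
  assumes "norm y \<le> 1" "d \<noteq> 0"
  obtains t :: real where "0 \<le> t" "norm (y + t *\<^sub>R d) = 1"
proof -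
  \<comment> \<open>This displacement has length 2, so it carries any point of the unit ball to norm
    at least \<open>2 - 1\<close>. The intermediate value theorem then finds a crossing of the
    sphere.\<close>
  have "1 \<le> norm (y + (2 / norm d) *\<^sub>R d)"
    using norm_diff_ineq[of "(2 / norm d) *\<^sub>R d" y] assms by (simp add: add.commute)
  then have "\<exists>t\<ge>0. t \<le> 2 / norm d \<and> norm (y + t *\<^sub>R d) = 1"
    using assms by (intro IVT') (auto intro!: continuous_intros)
  then show thesis using that by blast
qed

text \<open>A convex cone is closed under sums and nonnegative multiples, so adding
  \<open>t *\<^sub>R (A *v d)\<close> to \<open>A *v y - b\<close> does not leave
  \<open>K\<close>.\<close>

lemma feasible_add_recession:
  assumes "convex K" "cone K" "y \<in> feasible A b K" "A *v d \<in> K" "0 \<le> t" "norm (y + t *\<^sub>R d) \<le> 1"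
  shows "y + t *\<^sub>R d \<in> feasible A b K"
proof -
  have "(A *v y - b) + t *\<^sub>R (A *v d) \<in> K"
    using assms convex_cone[of K] by (auto simp: feasible_def cone_def)
  then show ?thesis
    using assms(6) by (simp add: feasible_def matrix_vector_right_distrib
        matrix_vector_mult_scaleR algebra_simps)
qed

theorem theorem4:
  fixes Q :: "real ^ 'n ^ 'n" and g :: "real ^ 'n"
    and A :: "real ^ 'n ^ 'm" and b :: "real ^ 'm" and K :: "(real ^ 'm) set"
  assumes "transpose Q = Q" and "lambda_min Q < 0"
    and "closed K" and "convex K" and "cone K"
    and "feasible A b K \<noteq> {}"
    and "\<exists>d. d \<noteq> 0 \<and> Q *v d = lambda_min Q *\<^sub>R d \<and> A *v d \<in> K \<and> g \<bullet> d \<le> 0"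
  shows "convex_relaxation (obj_f Q g) (obj_h Q g) (feasible A b K)
    \<and> (\<exists>y. is_arg_min (obj_f Q g) (\<lambda>y. y \<in> feasible A b K) y)
    \<and> (\<exists>y. is_arg_min (obj_h Q g) (\<lambda>y. y \<in> feasible A b K) y)
    \<and> opt_val (obj_f Q g) (feasible A b K) = opt_val (obj_h Q g) (feasible A b K)"
proof -
  let ?S = "feasible A b K" and ?f = "obj_f Q g" and ?h = "obj_h Q g"
  have le: "?f y \<le> ?h y" if "y \<in> ?S" for y
  proof -
    have "(norm y)\<^sup>2 \<le> 1" using that by (simp add: feasible_def power_le_one)
    \<comment> \<open>Negativity of \<open>lambda_min Q\<close> enters here: it makes
      \<open>f\<close> an underestimator of \<open>h\<close> on the ball.\<close>
    then have "lambda_min Q * (1 - (norm y)\<^sup>2) \<le> 0"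
      using assms(2) by (intro mult_nonpos_nonneg) auto
    then show ?thesis by (simp add: obj_f_def)
  qed
  have convex: "convex ?S" by (rule convex_feasible[OF assms(4)])
  have "convex_on ?S ?f"
    unfolding obj_f_quadratic
    by (intro convex_on_quadratic transpose_shift psd_shift_lambda_min assms(1) convex)
  with le convex have relax: "convex_relaxation ?f ?h ?S"
    by (simp add: convex_relaxation_def)
  obtain y where y: "is_arg_min ?f (\<lambda>y. y \<in> ?S) y"
  proof (rule is_arg_min_on_compact)
    show "continuous_on ?S ?f"
      unfolding obj_f_quadratic by (intro continuous_intros)
  qed (use assms(6) compact_feasible[OF assms(3)] in auto)
  then have yS: "y \<in> ?S" and y_min: "\<And>x. x \<in> ?S \<Longrightarrow> ?f y \<le> ?f x"
    by (auto simp: is_arg_min_linorder)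
  obtain d where d: "d \<noteq> 0" "Q *v d = lambda_min Q *\<^sub>R d" "A *v d \<in> K" "g \<bullet> d \<le> 0"
    using assms(7) by blast
  obtain t where t: "0 \<le> t" "norm (y + t *\<^sub>R d) = 1"
    using ray_meets_unit_sphere[of y d] yS d(1) by (auto simp: feasible_def)
  define z where "z = y + t *\<^sub>R d"
  have zS: "z \<in> ?S"
    unfolding z_def using t d yS assms(4,5) by (intro feasible_add_recession) auto
  \<comment> \<open>The term separating \<open>f\<close> from \<open>h\<close> vanishes on the unit
    sphere.\<close>
  have "?h z = ?f z" using t by (simp add: obj_f_def z_def)
  also have "\<dots> \<le> ?f y"
    using t(1) d(4) by (simp add: z_def obj_f_add_eigenvector[OF assms(1) d(2)] mult_nonneg_nonpos)
  finally have hz: "?h z \<le> ?f y" .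
  \<comment> \<open>For feasible \<open>x\<close>,
    \<open>?h z \<le> ?f y \<le> ?f x \<le> ?h x\<close>.\<close>
  have z: "is_arg_min ?h (\<lambda>y. y \<in> ?S) z"
    using zS hz y_min le by (fastforce simp: is_arg_min_linorder)
  \<comment> \<open>The cycle \<open>?f y \<le> ?f z \<le> ?h z \<le> ?f y\<close> forces
    equality.\<close>
  have "?f y = ?h z"
    using hz y_min[OF zS] le[OF zS] by linarith
  then have "opt_val ?f ?S = opt_val ?h ?S"
    by (simp add: opt_val_eq[OF y] opt_val_eq[OF z])
  with relax y z show ?thesis by blast
qed

end
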